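(* The $B$-closure model $$\frac1c\,\partial_t E_0+\partial_z E_1=r_0,\qquad \frac1c\,\partial_t E_1+\partial_z E_2=r_1,\qquad \frac1c\,\partial_t E_2+\partial_z E_3=r_2,$$ where $$E_3=E_3(E_0,E_1,E_2)=\frac{E_1\,(E_2^2+2E_1^2-3E_0E_2)}{2E_1^2-E_0E_2-E_0^2}$$ and $r_0,r_1,r_2$ are source terms depending only on $(E_0,E_1,E_2)$, is globally strictly hyperbolic in the interior of the realizable region $$\mathcal M=\{(E_0,E_1,E_2)\in\mathbb R^3:\ 0<E_2<E_0,\ E_1^2<E_0E_2\},$$ and its propagation speed is less than the speed of light $c$. That is, for every $(E_0,E_1,E_2)$ in the interior of $\mathcal M$, the Jacobian matrix $$\boldsymbol J=\begin{pmatrix}0&1&0\\0&0&1\\ \frac{\partial E_3}{\partial E_0}&\frac{\partial E_3}{\partial E_1}&\frac{\partial E_3}{\partial E_2}\end{pmatrix}$$ has three distinct real eigenvalues, and all of them lie in the open interval $(-1,1)$.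
   Context: Setting: $c>0$ is the speed of light, and $E_0,E_1,E_2$ are functions of time $t$ and of one space variable $z$, which approximate the angular moments $\int_{-1}^1\mu^jI(\mu)\,d\mu$ ($j=0,1,2$) of the specific intensity $I$ of the radiative transfer equation in slab geometry. The set $\mathcal M$ is the realizable moment region. The closure $E_3=\int_{-1}^1\mu^3\hat I(\mu)\,d\mu$ comes from the ansatz $$\hat I(\mu)=\frac{E_0}{2B(\xi,\eta)}\Big(\frac{\mu+1}{2}\Big)^{\xi-1}\Big(\frac{1-\mu}{2}\Big)^{\eta-1},\qquad \xi=\frac{\alpha}{\beta},\quad \eta=\frac{1-\alpha}{\beta},$$ where $B$ is the Beta function, $\alpha=\frac{E_1/E_0+1}{2}$ and $\beta=\frac{(E_1/E_0)^2-E_2/E_0}{E_2/E_0-1}$, which gives the explicit rational formula for $E_3$ in the claim. Since the time derivative carries the factor $1/c$, the characteristic (propagation) speeds of the system are $c\lambda$, where $\lambda$ runs over the eigenvalues of $\boldsymbol J$. *)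

theory Defs
  imports "HOL-Analysis.Analysis" "Jordan_Normal_Form.Char_Poly"
begin

definition closure_E3 :: "real \<Rightarrow> real \<Rightarrow> real \<Rightarrow> real" where
  "closure_E3 e0 e1 e2 =
     e1 * (e2\<^sup>2 + 2 * e1\<^sup>2 - 3 * e0 * e2) / (2 * e1\<^sup>2 - e0 * e2 - e0\<^sup>2)"

definition realizable_region :: "(real \<times> real \<times> real) set" where
  "realizable_region = {(e0, e1, e2). 0 < e2 \<and> e2 < e0 \<and> e1\<^sup>2 < e0 * e2}"

text \<open>The balance laws of the B-closure model at the point \<open>(t, z)\<close>; the fields
  are functions of time and space, in this order, and the source terms are functions of
  the three moments.\<close>

definition B_closure_model ::
  "real \<Rightarrow> (real \<Rightarrow> real \<Rightarrow> real \<Rightarrow> real) \<Rightarrow> (real \<Rightarrow> real \<Rightarrow> real \<Rightarrow> real)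
     \<Rightarrow> (real \<Rightarrow> real \<Rightarrow> real \<Rightarrow> real)
     \<Rightarrow> (real \<Rightarrow> real \<Rightarrow> real) \<Rightarrow> (real \<Rightarrow> real \<Rightarrow> real) \<Rightarrow> (real \<Rightarrow> real \<Rightarrow> real)
     \<Rightarrow> real \<Rightarrow> real \<Rightarrow> bool" where
  "B_closure_model c r0 r1 r2 E0 E1 E2 t z \<longleftrightarrow>
     1 / c * deriv (\<lambda>s. E0 s z) t + deriv (\<lambda>x. E1 t x) z
       = r0 (E0 t z) (E1 t z) (E2 t z) \<and>
     1 / c * deriv (\<lambda>s. E1 s z) t + deriv (\<lambda>x. E2 t x) z
       = r1 (E0 t z) (E1 t z) (E2 t z) \<and>
     1 / c * deriv (\<lambda>s. E2 s z) t + deriv (\<lambda>x. closure_E3 (E0 t x) (E1 t x) (E2 t x)) z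
       = r2 (E0 t z) (E1 t z) (E2 t z)"

definition B_closure_jacobian :: "real \<Rightarrow> real \<Rightarrow> real \<Rightarrow> real mat" where
  "B_closure_jacobian e0 e1 e2 = mat_of_rows_list 3
     [[0, 1, 0],
      [0, 0, 1],
      [deriv (\<lambda>x. closure_E3 x e1 e2) e0,
       deriv (\<lambda>x. closure_E3 e0 x e2) e1,
       deriv (\<lambda>x. closure_E3 e0 e1 x) e2]]"

text \<open>The quasilinear form \<open>(1/c) \<partial>\<^sub>t U + A(U) \<partial>\<^sub>z U = r(U)\<close> at the point \<open>(t, z)\<close>, for
  \<open>U = (E0, E1, E2)\<close>.\<close>

definition quasilinear_system ::
  "real \<Rightarrow> (real \<Rightarrow> real \<Rightarrow> real \<Rightarrow> real mat)
     \<Rightarrow> (real \<Rightarrow> real \<Rightarrow> real \<Rightarrow> real) \<Rightarrow> (real \<Rightarrow> real \<Rightarrow> real \<Rightarrow> real)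
     \<Rightarrow> (real \<Rightarrow> real \<Rightarrow> real \<Rightarrow> real)
     \<Rightarrow> (real \<Rightarrow> real \<Rightarrow> real) \<Rightarrow> (real \<Rightarrow> real \<Rightarrow> real) \<Rightarrow> (real \<Rightarrow> real \<Rightarrow> real)
     \<Rightarrow> real \<Rightarrow> real \<Rightarrow> bool" where
  "quasilinear_system c A r0 r1 r2 E0 E1 E2 t z \<longleftrightarrow>
     (1 / c) \<cdot>\<^sub>v vec_of_list [deriv (\<lambda>s. E0 s z) t, deriv (\<lambda>s. E1 s z) t, deriv (\<lambda>s. E2 s z) t]
     + A (E0 t z) (E1 t z) (E2 t z) *\<^sub>v
         vec_of_list [deriv (\<lambda>x. E0 t x) z, deriv (\<lambda>x. E1 t x) z, deriv (\<lambda>x. E2 t x) z]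
     = vec_of_list [r0 (E0 t z) (E1 t z) (E2 t z),
                    r1 (E0 t z) (E1 t z) (E2 t z),
                    r2 (E0 t z) (E1 t z) (E2 t z)]"

text \<open>For \<open>n \<times> n\<close> coefficient matrices: \<open>n\<close> distinct real eigenvalues in every state.
  The source terms do not enter.\<close>

definition strictly_hyperbolic_on ::
  "(real \<Rightarrow> real \<Rightarrow> real \<Rightarrow> real mat) \<Rightarrow> (real \<times> real \<times> real) set \<Rightarrow> bool" where
  "strictly_hyperbolic_on A S \<longleftrightarrow>
     (\<forall>(e0, e1, e2) \<in> S.
        square_mat (A e0 e1 e2) \<and> card {l. eigenvalue (A e0 e1 e2) l} = dim_row (A e0 e1 e2))"

text \<open>Multiplying the quasilinear form by \<open>c\<close> gives \<open>\<partial>\<^sub>t U + c A(U) \<partial>\<^sub>z U = c r(U)\<close>, so the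
  characteristic speeds are \<open>c\<close> times the eigenvalues of \<open>A(U)\<close>.\<close>

definition propagation_speeds :: "real \<Rightarrow> real mat \<Rightarrow> real set" where
  "propagation_speeds c A = {c * l |l. eigenvalue A l}"

end

theory Submission
  imports Defs
begin

text \<open>
  The characteristic polynomial of the Jacobian is a monic cubic \<open>p\<close>. In the normalised moments
  \<open>a = E1/E0\<close>, \<open>b = E2/E0\<close>, with \<open>K = 1 + b - 2 a\<^sup>2\<close>, let
  \<open>Q(l) = K l\<^sup>2 - 2 a (1 - b) l - (b + b\<^sup>2 - 2 a\<^sup>2)\<close> be the quadratic orthogonal polynomial of the
  Beta ansatz. Division with remainder gives
  \<open>K\<^sup>3 p(l) = (K\<^sup>2 l - a (1 - b)\<^sup>2) Q(l) - 2 (1 - b) (b - a\<^sup>2) ((1 + b)\<^sup>2 - 4 a\<^sup>2) (l - a)\<close>,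
  so at the two zeros of \<open>Q\<close>, which lie in \<open>(-1, a)\<close> and \<open>(a, 1)\<close>, the signs of \<open>p\<close> are
  \<open>+\<close> and \<open>-\<close>. Moreover \<open>K\<^sup>2 p(1) = (1 - b)\<^sup>2 (1 - a) (1 - 2 a + b)\<close> is positive and, by
  symmetry, \<open>p(-1)\<close> is negative. Hence \<open>p\<close> changes sign three times in \<open>(-1, 1)\<close>.
\<close>

unbundle no vec_syntax

section \<open>Partial derivatives of the closure\<close>

text \<open>The denominator equals \<open>2 * (e1\<^sup>2 - e0 * e2) + e0 * (e2 - e0)\<close>, a sum
  of two negative terms. Hence the closure has no pole in the region.\<close>

lemma closure_denom_neg:
  assumes "(e0, e1, e2) \<in> realizable_region"
  shows "2 * e1\<^sup>2 - e0 * e2 - e0\<^sup>2 < 0"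
proof -
  have "0 < e2" "e2 < e0" "e1\<^sup>2 < e0 * e2"
    using assms by (auto simp: realizable_region_def)
  moreover from this have "e0 * e2 < e0\<^sup>2" by (simp add: power2_eq_square)
  ultimately show ?thesis by linarith
qed

text \<open>\<open>jac0\<close>, \<open>jac1\<close> and \<open>jac2\<close> are the partial
  derivatives of \<open>closure_E3\<close> in its three arguments, left in the form that the
  quotient rule produces.\<close>

definition jac0 :: "real \<Rightarrow> real \<Rightarrow> real \<Rightarrow> real" where
  "jac0 x y w = ((- 3 * y * w) * (2 * y\<^sup>2 - x * w - x\<^sup>2)
     + (w + 2 * x) * (y * (w\<^sup>2 + 2 * y\<^sup>2 - 3 * x * w))) / (2 * y\<^sup>2 - x * w - x\<^sup>2)\<^sup>2"

definition jac1 :: "real \<Rightarrow> real \<Rightarrow> real \<Rightarrow> real" where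
  "jac1 x y w = ((w\<^sup>2 + 6 * y\<^sup>2 - 3 * x * w) * (2 * y\<^sup>2 - x * w - x\<^sup>2)
     - 4 * y * (y * (w\<^sup>2 + 2 * y\<^sup>2 - 3 * x * w))) / (2 * y\<^sup>2 - x * w - x\<^sup>2)\<^sup>2"

definition jac2 :: "real \<Rightarrow> real \<Rightarrow> real \<Rightarrow> real" where
  "jac2 x y w = ((2 * y * w - 3 * x * y) * (2 * y\<^sup>2 - x * w - x\<^sup>2)
     + x * (y * (w\<^sup>2 + 2 * y\<^sup>2 - 3 * x * w))) / (2 * y\<^sup>2 - x * w - x\<^sup>2)\<^sup>2"

text \<open>The chain rule along a curve serves two purposes: with one identity and two constant
  functions it yields the entries of the Jacobian, and with the three fields at a fixed time it
  yields the space derivative of the flux \<open>E3\<close>.\<close>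

lemma DERIV_closure_E3:
  fixes f g h :: "real \<Rightarrow> real"
  assumes [derivative_intros]: "DERIV f z :> f'" "DERIV g z :> g'" "DERIV h z :> h'"
    and D: "2 * (g z)\<^sup>2 - f z * h z - (f z)\<^sup>2 \<noteq> 0"
  shows "DERIV (\<lambda>x. closure_E3 (f x) (g x) (h x)) z :>
    jac0 (f z) (g z) (h z) * f' + jac1 (f z) (g z) (h z) * g' + jac2 (f z) (g z) (h z) * h'"
proof -
  define D where "D = 2 * (g z)\<^sup>2 - f z * h z - (f z)\<^sup>2"
  define N where "N = g z * ((h z)\<^sup>2 + 2 * (g z)\<^sup>2 - 3 * f z * h z)"
  define N' where "N' = - 3 * g z * h z * f' + ((h z)\<^sup>2 + 6 * (g z)\<^sup>2 - 3 * f z * h z) * g'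
    + (2 * g z * h z - 3 * f z * g z) * h'"
  define D' where "D' = - (h z + 2 * f z) * f' + 4 * g z * g' - f z * h'"
  have "DERIV (\<lambda>x. g x * ((h x)\<^sup>2 + 2 * (g x)\<^sup>2 - 3 * f x * h x)) z :> N'"
    unfolding N'_def
    by (auto intro!: derivative_eq_intros simp: algebra_simps power2_eq_square)
  moreover have "DERIV (\<lambda>x. 2 * (g x)\<^sup>2 - f x * h x - (f x)\<^sup>2) z :> D'"
    unfolding D'_def by (auto intro!: derivative_eq_intros simp: algebra_simps)
  ultimately have "DERIV (\<lambda>x. closure_E3 (f x) (g x) (h x)) z :> (N' * D - N * D') / (D * D)"
    unfolding closure_E3_def N_def D_def using D by (rule DERIV_divide)
  moreover have "(N' * D - N * D') / (D * D) =
    jac0 (f z) (g z) (h z) * f' + jac1 (f z) (g z) (h z) * g' + jac2 (f z) (g z) (h z) * h'"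
    unfolding jac0_def jac1_def jac2_def D_def[symmetric] N_def[symmetric]
    unfolding N'_def D'_def
    by (simp add: add_divide_distrib [symmetric] power2_eq_square[of D]) (simp add: algebra_simps)
  ultimately show ?thesis by simp
qed

lemma B_closure_jacobian_eq:
  assumes "(e0, e1, e2) \<in> realizable_region"
  shows "B_closure_jacobian e0 e1 e2 = mat_of_rows_list 3
     [[0, 1, 0], [0, 0, 1], [jac0 e0 e1 e2, jac1 e0 e1 e2, jac2 e0 e1 e2]]"
proof -
  have D: "2 * e1\<^sup>2 - e0 * e2 - e0\<^sup>2 \<noteq> 0"
    using closure_denom_neg[OF assms] by simp
  have "deriv (\<lambda>x. closure_E3 x e1 e2) e0 = jac0 e0 e1 e2"
    using DERIV_imp_deriv[OF DERIV_closure_E3[OF DERIV_ident DERIV_const DERIV_const D]] by simp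
  moreover have "deriv (\<lambda>x. closure_E3 e0 x e2) e1 = jac1 e0 e1 e2"
    using DERIV_imp_deriv[OF DERIV_closure_E3[OF DERIV_const DERIV_ident DERIV_const D]] by simp
  moreover have "deriv (\<lambda>x. closure_E3 e0 e1 x) e2 = jac2 e0 e1 e2"
    using DERIV_imp_deriv[OF DERIV_closure_E3[OF DERIV_const DERIV_const DERIV_ident D]] by simp
  ultimately show ?thesis unfolding B_closure_jacobian_def by simp
qed

section \<open>Differentiability and the quasilinear form\<close>

lemma closure_E3_differentiable:
  assumes "(e0, e1, e2) \<in> realizable_region"
  shows "(\<lambda>(x, y, w). closure_E3 x y w) differentiable (at (e0, e1, e2))"
proof -
  let ?F = "\<lambda>p :: real \<times> real \<times> real. fst (snd p) *
      ((snd (snd p))\<^sup>2 + 2 * (fst (snd p))\<^sup>2 - 3 * fst p * snd (snd p)) /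
      (2 * (fst (snd p))\<^sup>2 - fst p * snd (snd p) - (fst p)\<^sup>2)"
  note lin = bounded_linear_imp_differentiable
  have "fst differentiable F" for F :: "(real \<times> real \<times> real) filter"
    by (rule lin[OF bounded_linear_fst])
  moreover have "(\<lambda>p. fst (snd p)) differentiable F" for F :: "(real \<times> real \<times> real) filter"
    by (rule lin[OF bounded_linear_compose[OF bounded_linear_fst bounded_linear_snd]])
  moreover have "(\<lambda>p. snd (snd p)) differentiable F" for F :: "(real \<times> real \<times> real) filter"
    by (rule lin[OF bounded_linear_compose[OF bounded_linear_snd bounded_linear_snd]])
  ultimately have "?F differentiable (at (e0, e1, e2))"
    using closure_denom_neg[OF assms]
    by (intro differentiable_divide differentiable_mult differentiable_diff differentiable_add
        differentiable_power differentiable_const) auto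
  then show ?thesis by (simp add: closure_E3_def case_prod_unfold)
qed

text \<open>Fixing the time composes the field with the affine map
  \<open>x \<mapsto> (t, x)\<close>. This supplies the hypotheses of \<open>DERIV_closure_E3\<close>
  for the fields.\<close>

lemma differentiable_space_slice:
  fixes E :: "real \<Rightarrow> real \<Rightarrow> real"
  assumes "(\<lambda>(s, x). E s x) differentiable (at (t, z))"
  shows "DERIV (\<lambda>x. E t x) z :> deriv (\<lambda>x. E t x) z"
proof -
  have "(\<lambda>x. (t, x)) differentiable (at z)"
    unfolding differentiable_def by (rule exI) (rule derivative_intros)+
  then have "((\<lambda>(s, x). E s x) \<circ> (\<lambda>x. (t, x))) differentiable (at z)"
    using assms by (intro differentiable_chain_at) auto
  then have "(\<lambda>x. E t x) differentiable (at z)" by (simp add: o_def)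
  then show ?thesis
    by (simp add: DERIV_deriv_iff_real_differentiable)
qed

text \<open>The first two rows of the matrix reproduce the first two balance laws; the third row is
  the chain rule applied to the flux.\<close>

lemma B_closure_model_iff_quasilinear:
  assumes R: "(E0 t z, E1 t z, E2 t z) \<in> realizable_region"
    and diff: "\<forall>E \<in> {E0, E1, E2}. (\<lambda>(s, x). E s x) differentiable (at (t, z))"
  shows "B_closure_model c r0 r1 r2 E0 E1 E2 t z
    \<longleftrightarrow> quasilinear_system c B_closure_jacobian r0 r1 r2 E0 E1 E2 t z"
proof -
  have D: "2 * (E1 t z)\<^sup>2 - E0 t z * E2 t z - (E0 t z)\<^sup>2 \<noteq> 0"
    using closure_denom_neg[OF R] by simp
  have "deriv (\<lambda>x. closure_E3 (E0 t x) (E1 t x) (E2 t x)) z =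
      jac0 (E0 t z) (E1 t z) (E2 t z) * deriv (\<lambda>x. E0 t x) z
      + jac1 (E0 t z) (E1 t z) (E2 t z) * deriv (\<lambda>x. E1 t x) z
      + jac2 (E0 t z) (E1 t z) (E2 t z) * deriv (\<lambda>x. E2 t x) z"
    by (rule DERIV_imp_deriv, rule DERIV_closure_E3)
      (use diff D in \<open>auto intro: differentiable_space_slice\<close>)
  then show ?thesis
    unfolding B_closure_model_def quasilinear_system_def B_closure_jacobian_eq[OF R]
    by (auto simp: vec_eq_iff mat_of_rows_list_def scalar_prod_def numeral_3_eq_3
        less_Suc_eq vec_of_list_index add.assoc all_conj_distrib)
qed

section \<open>Eigenvalues of companion matrices of size three\<close>

lemma vec3_eq_iff:
  assumes "u \<in> carrier_vec 3" "v \<in> carrier_vec 3"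
  shows "u = v \<longleftrightarrow> u $ 0 = v $ 0 \<and> u $ 1 = v $ 1 \<and> u $ 2 = v $ 2"
proof
  assume *: "u $ 0 = v $ 0 \<and> u $ 1 = v $ 1 \<and> u $ 2 = v $ 2"
  show "u = v"
  proof (rule eq_vecI)
    fix i assume "i < dim_vec v"
    then have "i = 0 \<or> i = 1 \<or> i = 2" using assms(2) by auto
    with * show "u $ i = v $ i" by blast
  qed (use assms in auto)
qed simp

lemma companion3_mult_vec:
  fixes p q r :: "'a :: comm_ring_1"
  assumes "v \<in> carrier_vec 3"
  shows "mat_of_rows_list 3 [[0, 1, 0], [0, 0, 1], [p, q, r]] *\<^sub>v v =
    vec_of_list [v $ 1, v $ 2, p * v $ 0 + q * v $ 1 + r * v $ 2]" (is "?A *\<^sub>v v = ?w")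
proof (rule eq_vecI)
  fix i assume "i < dim_vec ?w"
  then have "i < 3" by simp
  then have i: "i = 0 \<or> i = 1 \<or> i = 2" by linarith
  have "{0..<3} = {0, 1, 2 :: nat}" by auto
  moreover have "(?A *\<^sub>v v) $ i =
      (\<Sum>j\<in>{0..<3}. [[0, 1, 0], [0, 0, 1], [p, q, r]] ! i ! j * v $ j)"
    using \<open>i < 3\<close> assms by (simp add: mat_of_rows_list_def scalar_prod_def)
  ultimately show "(?A *\<^sub>v v) $ i = ?w $ i"
    using i by (elim disjE) (simp_all add: vec_of_list_index add.assoc del: vec_of_list_Cons)
qed (simp add: mat_of_rows_list_def)

text \<open>The first two rows force an eigenvector to be a multiple of
  \<open>(1, l, l\<^sup>2)\<close>, and the last row then becomes the cubic equation. This avoids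
  determinants.\<close>

lemma eigenvalue_companion3_iff:
  fixes p q r l :: real
  shows "eigenvalue (mat_of_rows_list 3 [[0, 1, 0], [0, 0, 1], [p, q, r]]) l
    \<longleftrightarrow> l ^ 3 - r * l\<^sup>2 - q * l - p = 0" (is "eigenvalue ?A l \<longleftrightarrow> _")
proof -
  have eq: "?A *\<^sub>v v = l \<cdot>\<^sub>v v \<longleftrightarrow>
      v $ 1 = l * v $ 0 \<and> v $ 2 = l * v $ 1 \<and> p * v $ 0 + q * v $ 1 + r * v $ 2 = l * v $ 2"
    if v: "v \<in> carrier_vec 3" for v :: "real Matrix.vec"
  proof -
    have w: "vec_of_list [v $ 1, v $ 2, p * v $ 0 + q * v $ 1 + r * v $ 2] \<in> carrier_vec 3"
      by (rule carrier_vecI) simp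
    have lv: "l \<cdot>\<^sub>v v \<in> carrier_vec 3" "dim_vec v = 3" using v by auto
    show ?thesis
      unfolding companion3_mult_vec[OF v] vec3_eq_iff[OF w lv(1)]
      using lv(2) by (simp add: vec_of_list_index del: vec_of_list_Cons)
  qed
  have dim: "dim_row ?A = 3" by (simp add: mat_of_rows_list_def)
  show ?thesis
  proof
    assume "eigenvalue ?A l"
    then obtain v where v: "v \<in> carrier_vec 3" "v \<noteq> 0\<^sub>v 3" "?A *\<^sub>v v = l \<cdot>\<^sub>v v"
      by (auto simp: eigenvalue_def eigenvector_def dim)
    then have e: "v $ 1 = l * v $ 0" "v $ 2 = l * v $ 1"
      "p * v $ 0 + q * v $ 1 + r * v $ 2 = l * v $ 2"
      using eq by auto
    have "v $ 0 \<noteq> 0"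
    proof
      assume "v $ 0 = 0"
      then have "v $ 1 = 0" "v $ 2 = 0" using e by auto
      with \<open>v $ 0 = 0\<close> v(1) have "v = 0\<^sub>v 3"
        by (subst vec3_eq_iff) auto
      with v(2) show False by simp
    qed
    moreover have "v $ 0 * (l ^ 3 - r * l\<^sup>2 - q * l - p) = 0"
      using e(3) unfolding e(2) unfolding e(1)
      by (simp add: power2_eq_square power3_eq_cube algebra_simps)
    ultimately show "l ^ 3 - r * l\<^sup>2 - q * l - p = 0" by simp
  next
    assume l: "l ^ 3 - r * l\<^sup>2 - q * l - p = 0"
    define v where "v = vec_of_list [1, l, l\<^sup>2]"
    have i: "v \<in> carrier_vec 3" "v $ 0 = 1" "v $ 1 = l" "v $ 2 = l\<^sup>2"
      unfolding v_def by (rule carrier_vecI) (simp_all add: vec_of_list_index del: vec_of_list_Cons)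
    then have "v \<noteq> 0\<^sub>v 3" by auto
    moreover have "?A *\<^sub>v v = l \<cdot>\<^sub>v v"
      unfolding eq[OF i(1)] i(2-4) using l
      by (simp add: power2_eq_square power3_eq_cube)
    ultimately show "eigenvalue ?A l"
      using i(1) by (auto simp: eigenvalue_def eigenvector_def dim)
  qed
qed

section \<open>Real zeros of monic cubics\<close>

text \<open>Alternating signs give three zeros by the intermediate value theorem, and the degree
  bound shows that there are no others.\<close>

lemma monic_cubic_three_roots:
  fixes p q r s t :: real
  defines "f \<equiv> \<lambda>l. l ^ 3 - r * l\<^sup>2 - q * l - p"
  assumes "x0 < x1" "x1 < x2" "x2 < x3"
    and "f x0 < 0" "f x1 > 0" "f x2 < 0" "f x3 > 0"
  shows "card {l. f l = 0} = 3" and "{l. f l = 0} \<subseteq> {x0<..<x3}"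
proof -
  have cont: "continuous_on A f" for A
    unfolding f_def by (intro continuous_intros)
  obtain y1 where y1: "x0 \<le> y1" "y1 \<le> x1" "f y1 = 0"
    using IVT'[of f x0 0 x1] assms cont by auto
  obtain y2 where y2: "x1 \<le> y2" "y2 \<le> x2" "f y2 = 0"
    using IVT2'[of f x2 0 x1] assms cont by auto
  obtain y3 where y3: "x2 \<le> y3" "y3 \<le> x3" "f y3 = 0"
    using IVT'[of f x2 0 x3] assms cont by auto
  \<comment> \<open>The zeros were found in closed intervals that share endpoints; the strict signs
    exclude the endpoints, so the zeros are distinct.\<close>
  have ne: "y1 \<noteq> x0" "y1 \<noteq> x1" "y2 \<noteq> x1" "y2 \<noteq> x2" "y3 \<noteq> x2" "y3 \<noteq> x3"
    using y1 y2 y3 assms by auto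
  then have ord: "x0 < y1" "y1 < y2" "y2 < y3" "y3 < x3"
    using y1 y2 y3 by linarith+
  define P where "P = [:- p, - q, - r, 1:]"
  have P: "poly P l = f l" for l
    by (simp add: P_def f_def power2_eq_square power3_eq_cube algebra_simps)
  have "P \<noteq> 0" "degree P = 3" by (simp_all add: P_def)
  then have "finite {l. f l = 0}" "card {l. f l = 0} \<le> 3"
    using poly_roots_finite[of P] card_poly_roots_bound[of P] by (simp_all add: P)
  moreover have "{y1, y2, y3} \<subseteq> {l. f l = 0}" "card {y1, y2, y3} = 3"
    using y1 y2 y3 ord by auto
  ultimately have eq: "{y1, y2, y3} = {l. f l = 0}"
    by (intro card_seteq) auto
  with \<open>card {y1, y2, y3} = 3\<close> show "card {l. f l = 0} = 3" by simp
  show "{l. f l = 0} \<subseteq> {x0<..<x3}"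
    using ord unfolding eq[symmetric] by auto
qed

section \<open>The characteristic cubic in normalised moments\<close>

text \<open>The characteristic polynomial of the Jacobian at the state
  \<open>(1, a, b)\<close>.\<close>

definition char_cubic :: "real \<Rightarrow> real \<Rightarrow> real \<Rightarrow> real" where
  "char_cubic a b l = l ^ 3 - jac2 1 a b * l\<^sup>2 - jac1 1 a b * l - jac0 1 a b"

text \<open>Orthogonal to 1 and to the identity for the functional with moments 1, \<open>a\<close>,
  \<open>b\<close>, \<open>closure_E3 1 a b\<close>; the second orthogonality is the closure
  relation itself.\<close>

definition jacobi_quadratic :: "real \<Rightarrow> real \<Rightarrow> real \<Rightarrow> real" where
  "jacobi_quadratic a b l =
     (1 + b - 2 * a\<^sup>2) * l\<^sup>2 - 2 * a * (1 - b) * l - (b + b\<^sup>2 - 2 * a\<^sup>2)"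

text \<open>Clearing the common denominator turns the later identities into polynomial ones, which
  ring normalisation can decide.\<close>

lemma char_cubic_scaled:
  assumes "1 + b - 2 * a\<^sup>2 \<noteq> 0"
  shows "(1 + b - 2 * a\<^sup>2)\<^sup>2 * char_cubic a b l =
    (1 + b - 2 * a\<^sup>2)\<^sup>2 * l ^ 3
    - (a * (b\<^sup>2 + 2 * a\<^sup>2 - 3 * b) - (2 * a * b - 3 * a) * (1 + b - 2 * a\<^sup>2)) * l\<^sup>2
    + ((b\<^sup>2 + 6 * a\<^sup>2 - 3 * b) * (1 + b - 2 * a\<^sup>2)
        + 4 * a\<^sup>2 * (b\<^sup>2 + 2 * a\<^sup>2 - 3 * b)) * l
    - 3 * a * b * (1 + b - 2 * a\<^sup>2) - (b + 2) * (a * (b\<^sup>2 + 2 * a\<^sup>2 - 3 * b))"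
proof -
  define K where "K = 1 + b - 2 * a\<^sup>2"
  have D: "(2 * a\<^sup>2 - 1 * b - 1\<^sup>2)\<^sup>2 = K\<^sup>2"
    unfolding K_def by (simp add: algebra_simps power2_eq_square)
  have K: "K\<^sup>2 \<noteq> 0" using assms by (simp add: K_def)
  \<comment> \<open>\<open>K\<close> stays opaque until the fractions are gone, and is expanded only
    for the final polynomial identity.\<close>
  have cancel: "K\<^sup>2 * (x - p / K\<^sup>2 * y - q / K\<^sup>2 * l - r / K\<^sup>2) = K\<^sup>2 * x - p * y - q * l - r"
    for x y p q r :: real
    using K by (simp add: right_diff_distrib)
  show ?thesis
    unfolding char_cubic_def jac0_def jac1_def jac2_def D K_def[symmetric] cancel
    unfolding K_def power_one mult_1_left by Groebner_Basis.algebra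
qed

text \<open>The third power is needed for a polynomial quotient: with the square, the constant term
  of the quotient would be \<open>- a * (1 - b)\<^sup>2\<close> divided by
  \<open>1 + b - 2 * a\<^sup>2\<close>.\<close>

lemma char_cubic_division:
  assumes "1 + b - 2 * a\<^sup>2 \<noteq> 0"
  shows "(1 + b - 2 * a\<^sup>2) ^ 3 * char_cubic a b l =
    ((1 + b - 2 * a\<^sup>2)\<^sup>2 * l - a * (1 - b)\<^sup>2) * jacobi_quadratic a b l
    - 2 * (1 - b) * (b - a\<^sup>2) * ((1 + b)\<^sup>2 - 4 * a\<^sup>2) * (l - a)"
proof -
  have "(1 + b - 2 * a\<^sup>2) ^ 3 * char_cubic a b l =
    (1 + b - 2 * a\<^sup>2) * ((1 + b - 2 * a\<^sup>2)\<^sup>2 * char_cubic a b l)"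
    by (simp only: power2_eq_square power3_eq_cube mult.assoc)
  also have "\<dots> = ((1 + b - 2 * a\<^sup>2)\<^sup>2 * l - a * (1 - b)\<^sup>2) * jacobi_quadratic a b l
    - 2 * (1 - b) * (b - a\<^sup>2) * ((1 + b)\<^sup>2 - 4 * a\<^sup>2) * (l - a)"
    unfolding char_cubic_scaled[OF assms] jacobi_quadratic_def
    by Groebner_Basis.algebra
  finally show ?thesis .
qed

lemma char_cubic_one:
  assumes "1 + b - 2 * a\<^sup>2 \<noteq> 0"
  shows "(1 + b - 2 * a\<^sup>2)\<^sup>2 * char_cubic a b 1 = (1 - b)\<^sup>2 * (1 - a) * (1 - 2 * a + b)"
  unfolding char_cubic_scaled[OF assms] power_one mult_1_right by Groebner_Basis.algebra

text \<open>This mirrors \<open>char_cubic_one\<close>: the cubic changes sign when \<open>a\<close>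
  and \<open>l\<close> are both negated. The proof checks the identity directly.\<close>

lemma char_cubic_minus_one:
  assumes "1 + b - 2 * a\<^sup>2 \<noteq> 0"
  shows "(1 + b - 2 * a\<^sup>2)\<^sup>2 * char_cubic a b (- 1) = - ((1 - b)\<^sup>2 * (1 + a) * (1 + 2 * a + b))"
  unfolding char_cubic_scaled[OF assms] power3_eq_cube power2_minus power_one mult_1_right mult_minus_right
  by Groebner_Basis.algebra

lemma char_cubic_roots:
  fixes a b :: real
  assumes ab: "a\<^sup>2 < b" and b: "b < 1"
  shows "card {l. char_cubic a b l = 0} = 3" and "{l. char_cubic a b l = 0} \<subseteq> {- 1<..<1}"
proof -
  define K where "K = 1 + b - 2 * a\<^sup>2"
  have K: "K > 0" using assms by (simp add: K_def)
  then have K0: "1 + b - 2 * a\<^sup>2 \<noteq> 0" by (simp add: K_def)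
  have "\<bar>a\<bar> < 1"
    using assms abs_square_less_1[of a] by simp
  then have a: "- 1 < a" "a < 1" by auto
  \<comment> \<open>Since \<open>b\<close> exceeds \<open>a\<^sup>2\<close>, these quantities exceed
    the squares of \<open>1 - a\<close> and \<open>1 + a\<close>.\<close>
  have b1: "1 + b - 2 * a > 0" "1 + b + 2 * a > 0"
    using ab zero_le_power2[of "1 - a"] zero_le_power2[of "1 + a"]
    by (simp_all add: power2_eq_square algebra_simps)
  have W: "(1 + b)\<^sup>2 - 4 * a\<^sup>2 > 0"
    using mult_pos_pos[OF b1] by (simp add: power2_eq_square algebra_simps)
  let ?Q = "jacobi_quadratic a b"
  have cont: "continuous_on A ?Q" for A
    unfolding jacobi_quadratic_def by (intro continuous_intros)
  \<comment> \<open>The signs of the quadratic at \<open>-1\<close>, \<open>a\<close> and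
    \<open>1\<close> place one zero on each side of \<open>a\<close>, inside the interval.\<close>
  have Qa: "?Q a < 0"
  proof -
    have "?Q a = - ((b - a\<^sup>2) * K)"
      unfolding jacobi_quadratic_def K_def by Groebner_Basis.algebra
    then show ?thesis using K ab by simp
  qed
  have Q1: "?Q 1 > 0"
  proof -
    have "?Q 1 = (1 - b) * (1 + b - 2 * a)"
      unfolding jacobi_quadratic_def power2_minus power_one by Groebner_Basis.algebra
    then show ?thesis using b b1 by simp
  qed
  have Qm1: "?Q (- 1) > 0"
  proof -
    have "?Q (- 1) = (1 - b) * (1 + b + 2 * a)"
      unfolding jacobi_quadratic_def power2_minus power_one by Groebner_Basis.algebra
    then show ?thesis using b b1 by simp
  qed
  obtain x1 where x1: "- 1 \<le> x1" "x1 \<le> a" "?Q x1 = 0"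
    using IVT2'[of ?Q a 0 "- 1"] Qa Qm1 a cont by force
  obtain x2 where x2: "a \<le> x2" "x2 \<le> 1" "?Q x2 = 0"
    using IVT'[of ?Q a 0 1] Qa Q1 a cont by force
  have "x1 \<noteq> - 1" "x1 \<noteq> a" "x2 \<noteq> a" "x2 \<noteq> 1"
    using x1 x2 Qa Q1 Qm1 by auto
  then have ord: "- 1 < x1" "x1 < a" "a < x2" "x2 < 1"
    using x1 x2 by auto
  define C where "C = 2 * (1 - b) * (b - a\<^sup>2) * ((1 + b)\<^sup>2 - 4 * a\<^sup>2)"
  have C: "C > 0" unfolding C_def using W assms by simp
  \<comment> \<open>At a zero of the quadratic only the remainder of the division survives, so the
    position relative to \<open>a\<close> decides the sign.\<close>
  have at_zero: "K ^ 3 * char_cubic a b x = C * (a - x)" if "?Q x = 0" for x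
    using char_cubic_division[OF K0, of x] that by (simp add: K_def C_def algebra_simps)
  have "K ^ 3 * char_cubic a b x1 > 0"
    unfolding at_zero[OF x1(3)] using C ord by simp
  then have p1: "char_cubic a b x1 > 0"
    using K by (simp add: zero_less_mult_iff)
  have "K ^ 3 * char_cubic a b x2 < 0"
    unfolding at_zero[OF x2(3)] using C ord by (simp add: mult_less_0_iff)
  then have p2: "char_cubic a b x2 < 0"
    using K by (simp add: mult_less_0_iff)
  have "K\<^sup>2 * char_cubic a b 1 > 0"
    using a b b1 unfolding K_def char_cubic_one[OF K0] by simp
  then have p3: "char_cubic a b 1 > 0"
    using K by (simp add: zero_less_mult_iff)
  have "K\<^sup>2 * char_cubic a b (- 1) < 0"
    using a b b1 unfolding K_def char_cubic_minus_one[OF K0] by simp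
  then have p0: "char_cubic a b (- 1) < 0"
    using K by (simp add: mult_less_0_iff)
  have x12: "x1 < x2" using ord by simp
  note roots = monic_cubic_three_roots[OF ord(1) x12 ord(4),
      of "jac2 1 a b" "jac1 1 a b" "jac0 1 a b", folded char_cubic_def, OF p0 p1 p2 p3]
  show "card {l. char_cubic a b l = 0} = 3" by (rule roots(1))
  show "{l. char_cubic a b l = 0} \<subseteq> {- 1<..<1}" by (rule roots(2))
qed

section \<open>From normalised to general moments\<close>

text \<open>The closure is homogeneous of degree 1, hence its partial derivatives are homogeneous of
  degree 0.\<close>

lemma jac_homogeneous:
  assumes "x \<noteq> 0"
  shows "jac0 x y w = jac0 1 (y / x) (w / x)"
    and "jac1 x y w = jac1 1 (y / x) (w / x)"
    and "jac2 x y w = jac2 1 (y / x) (w / x)"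
proof -
  define a b where "a = y / x" and "b = w / x"
  have yw: "y = x * a" "w = x * b" using assms by (simp_all add: a_def b_def)
  \<comment> \<open>Numerators and denominators of the three quotients are homogeneous of degree 4,
    so \<open>x ^ 4\<close> cancels.\<close>
  have D: "(2 * (x * a)\<^sup>2 - x * (x * b) - x\<^sup>2)\<^sup>2 = x ^ 4 * (2 * a\<^sup>2 - 1 * b - 1\<^sup>2)\<^sup>2"
    by (simp add: algebra_simps power2_eq_square power4_eq_xxxx)
  have cancel: "m / (x ^ 4 * d) = n / d" if "m = x ^ 4 * n" for m n d :: real
    using that assms by simp
  show "jac0 x y w = jac0 1 (y / x) (w / x)" "jac1 x y w = jac1 1 (y / x) (w / x)"
    "jac2 x y w = jac2 1 (y / x) (w / x)"
    unfolding a_def[symmetric] b_def[symmetric]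
    unfolding yw jac0_def jac1_def jac2_def D
    by (rule cancel, simp only: power_one mult_1_left mult_1_right, Groebner_Basis.algebra)+
qed

text \<open>By homogeneity the Jacobian is the same at the state divided by \<open>e0\<close>, where
  its characteristic polynomial is \<open>char_cubic\<close>.\<close>

lemma eigenvalue_B_closure_jacobian_iff:
  assumes "(e0, e1, e2) \<in> realizable_region"
  shows "eigenvalue (B_closure_jacobian e0 e1 e2) l \<longleftrightarrow> char_cubic (e1 / e0) (e2 / e0) l = 0"
proof -
  have "e0 \<noteq> 0" using assms by (auto simp: realizable_region_def)
  note hom = jac_homogeneous[OF this, of e1 e2]
  show ?thesis
    unfolding B_closure_jacobian_eq[OF assms] eigenvalue_companion3_iff char_cubic_def
      hom[symmetric] by (rule refl)
qed

lemma B_closure_jacobian_spectrum: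
  assumes "(e0, e1, e2) \<in> realizable_region"
  shows "card {l. eigenvalue (B_closure_jacobian e0 e1 e2) l} = 3"
    and "{l. eigenvalue (B_closure_jacobian e0 e1 e2) l} \<subseteq> {- 1<..<1}"
proof -
  have e: "0 < e2" "e2 < e0" "e1\<^sup>2 < e0 * e2"
    using assms by (auto simp: realizable_region_def)
  then have "e0 > 0" by simp
  with e have "(e1 / e0)\<^sup>2 < e2 / e0" "e2 / e0 < 1"
    by (simp_all add: field_simps power2_eq_square)
  from char_cubic_roots[OF this]
  show "card {l. eigenvalue (B_closure_jacobian e0 e1 e2) l} = 3"
    and "{l. eigenvalue (B_closure_jacobian e0 e1 e2) l} \<subseteq> {- 1<..<1}"
    by (simp_all add: eigenvalue_B_closure_jacobian_iff[OF assms])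
qed

text \<open>The first two conjuncts tie the matrix to the model: the closure is jointly
  differentiable, and the matrix is the coefficient matrix of the balance laws. The other two
  concern its spectrum.\<close>

theorem theorem3p1:
  fixes c :: real and r0 r1 r2 :: "real \<Rightarrow> real \<Rightarrow> real \<Rightarrow> real"
  assumes "c > 0"
  shows
    "(\<forall>(e0, e1, e2) \<in> interior realizable_region.
        (\<lambda>(x, y, w). closure_E3 x y w) differentiable (at (e0, e1, e2)))
     \<and> (\<forall>E0 E1 E2 t z.
          (E0 t z, E1 t z, E2 t z) \<in> interior realizable_region
          \<and> (\<forall>E \<in> {E0, E1, E2}. (\<lambda>(s, x). E s x) differentiable (at (t, z)))
          \<longrightarrow> (B_closure_model c r0 r1 r2 E0 E1 E2 t z
               \<longleftrightarrow> quasilinear_system c B_closure_jacobian r0 r1 r2 E0 E1 E2 t z))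
     \<and> strictly_hyperbolic_on B_closure_jacobian (interior realizable_region)
     \<and> (\<forall>(e0, e1, e2) \<in> interior realizable_region.
          card {l. eigenvalue (B_closure_jacobian e0 e1 e2) l} = 3
          \<and> (\<forall>l. eigenvalue (B_closure_jacobian e0 e1 e2) l \<longrightarrow> l \<in> {-1<..<1})
          \<and> (\<forall>v \<in> propagation_speeds c (B_closure_jacobian e0 e1 e2). \<bar>v\<bar> < c))"
proof -
  \<comment> \<open>All previous lemmas hold on the region itself, so the interior enters through
    this inclusion.\<close>
  have sub: "p \<in> realizable_region" if "p \<in> interior realizable_region" for p
    using that interior_subset by blast
  have dims: "square_mat (B_closure_jacobian e0 e1 e2)" "dim_row (B_closure_jacobian e0 e1 e2) = 3"
    for e0 e1 e2
    by (simp_all add: B_closure_jacobian_def mat_of_rows_list_def)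
  have speed: "\<bar>v\<bar> < c"
    if e: "(e0, e1, e2) \<in> realizable_region"
      and v: "v \<in> propagation_speeds c (B_closure_jacobian e0 e1 e2)"
    for e0 e1 e2 v
  proof -
    obtain l where l: "v = c * l" "eigenvalue (B_closure_jacobian e0 e1 e2) l"
      using v by (auto simp: propagation_speeds_def)
    then have "l \<in> {- 1<..<1}" using B_closure_jacobian_spectrum(2)[OF e] by blast
    then have "c * \<bar>l\<bar> < c * 1" using assms by (intro mult_strict_left_mono) auto
    then show ?thesis using assms l(1) by (simp add: abs_mult)
  qed
  have "strictly_hyperbolic_on B_closure_jacobian (interior realizable_region)"
    unfolding strictly_hyperbolic_on_def
    using B_closure_jacobian_spectrum(1)[OF sub] dims by auto
  moreover have "\<forall>(e0, e1, e2) \<in> interior realizable_region.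
      card {l. eigenvalue (B_closure_jacobian e0 e1 e2) l} = 3
      \<and> (\<forall>l. eigenvalue (B_closure_jacobian e0 e1 e2) l \<longrightarrow> l \<in> {-1<..<1})
      \<and> (\<forall>v \<in> propagation_speeds c (B_closure_jacobian e0 e1 e2). \<bar>v\<bar> < c)"
    using B_closure_jacobian_spectrum[OF sub] speed[OF sub] by blast
  moreover have "\<forall>(e0, e1, e2) \<in> interior realizable_region.
      (\<lambda>(x, y, w). closure_E3 x y w) differentiable (at (e0, e1, e2))"
    using closure_E3_differentiable[OF sub] by blast
  ultimately show ?thesis
    using B_closure_model_iff_quasilinear[OF sub] by blast
qed

end
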